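(* Let $p$ be a prime, let $G$ be a finite $p$-group, and let $n, k$ be integers with $n \leq k+1$. Suppose that (1) there exist two proper subgroups $H_1, H_2$ of $G$ such that every element $x \in G$ with $b(x) \geq n$ lies in $H_1 \cup H_2$, and (2) $G$ is generated by the set of elements $x \in G$ with $b(x) \leq k$. Then $\log_p |G'| \leq \frac{(n-1)(n-2)}{2} + k$.
   Context: $G'$ denotes the derived subgroup of $G$. For $x$ in a finite $p$-group $G$, the breadth $b(x)$ is defined by $|G : C_G(x)| = p^{b(x)}$, where $C_G(x)$ is the centralizer of $x$ in $G$. *)

theory Defs
  imports "HOL-Algebra.Algebra" "HOL-Analysis.Analysis"
begin

definition centralizer_elem :: "('a, 'b) monoid_scheme \<Rightarrow> 'a \<Rightarrow> 'a set" where
  "centralizer_elem G x = {g \<in> carrier G. g \<otimes>\<^bsub>G\<^esub> x = x \<otimes>\<^bsub>G\<^esub> g}"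

definition breadth :: "('a, 'b) monoid_scheme \<Rightarrow> nat \<Rightarrow> 'a \<Rightarrow> real" where
  "breadth G p x = log (real p) (real (card (carrier G)) / real (card (centralizer_elem G x)))"

end

theory Submission
  imports Defs
begin

text \<open>
  Induction on the order of \<open>G\<close>, passing to a maximal subgroup \<open>M\<close>, with \<open>m = n - 1\<close>. For
  \<open>w \<notin> M\<close> let \<open>E\<close> be the subgroup of all \<open>e \<in> M\<close> with \<open>[e, w] \<in> M'\<close>. The map
  \<open>x \<mapsto> [x, w] M'\<close> sends \<open>M\<close> onto \<open>G'/M'\<close> with fibres the cosets of \<open>E\<close>, so
  \<open>|G' : M'| = |M : E|\<close> is at most \<open>p\<close> to the breadth of \<open>w\<close>. If \<open>y \<in> M - E\<close>, then
  \<open>C\<^sub>G(y) \<subseteq> M\<close>, because an element outside \<open>M\<close> commuting with \<open>y\<close> would make \<open>y\<close> central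
  modulo \<open>M'\<close>; hence the breadth of \<open>y\<close> in \<open>M\<close> is one less than in \<open>G\<close>.
  Choosing \<open>M\<close> so that \<open>M \<inter> (H\<^sub>1 \<union> H\<^sub>2)\<close> lies in a single proper subgroup \<open>D\<close> of \<open>M\<close>, the pair
  \<open>D, E\<close> takes the place of \<open>H\<^sub>1, H\<^sub>2\<close>. The complement of \<open>D \<union> E\<close> generates \<open>M\<close> unless
  \<open>|M : E| = p\<close>, and in that case the weaker bound on the generators of \<open>M\<close> is made up for by
  the small index of \<open>M'\<close> in \<open>G'\<close>.
\<close>

section \<open>Commutators, coset counting and proper subgroups\<close>

abbreviation commutator :: "('a, 'b) monoid_scheme \<Rightarrow> 'a \<Rightarrow> 'a \<Rightarrow> 'a" where
  "commutator G x y \<equiv> x \<otimes>\<^bsub>G\<^esub> y \<otimes>\<^bsub>G\<^esub> inv\<^bsub>G\<^esub> x \<otimes>\<^bsub>G\<^esub> inv\<^bsub>G\<^esub> y"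

definition maximal_subgroup :: "'a set \<Rightarrow> ('a, 'b) monoid_scheme \<Rightarrow> bool" where
  "maximal_subgroup M G \<longleftrightarrow> subgroup M G \<and> M \<noteq> carrier G \<and>
     (\<forall>L. subgroup L G \<longrightarrow> M \<subseteq> L \<longrightarrow> L = M \<or> L = carrier G)"

context group
begin

lemma inv_mult_cancel [simp]:
  assumes "x \<in> carrier G" "y \<in> carrier G"
  shows "inv x \<otimes> (x \<otimes> y) = y" "x \<otimes> (inv x \<otimes> y) = y"
  using assms by (simp_all add: m_assoc[symmetric])

lemma commutator_eq_one_iff:
  assumes "x \<in> carrier G" "y \<in> carrier G"
  shows "commutator G x y = \<one> \<longleftrightarrow> x \<otimes> y = y \<otimes> x"
proof -
  have "commutator G x y = \<one> \<longleftrightarrow> commutator G x y \<otimes> (y \<otimes> x) = \<one> \<otimes> (y \<otimes> x)"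
    using assms by (intro right_cancel[symmetric]) auto
  then show ?thesis using assms by (simp add: m_assoc)
qed

lemma inv_commutator:
  assumes "x \<in> carrier G" "y \<in> carrier G"
  shows "inv (commutator G x y) = commutator G y x"
  using assms by (simp add: inv_mult_group m_assoc)

text \<open>These are the \<open>h\<close> commuting with \<open>y\<close> modulo \<open>N\<close>,
  the preimage of a centralizer in the quotient. Closure follows from
  \<open>[y, ab] = [y, a] (a [y, b] a^-1)\<close> and normality of \<open>N\<close>.\<close>

lemma commutator_subgroup:
  assumes "N \<lhd> G" "y \<in> carrier G"
  shows "subgroup {h \<in> carrier G. commutator G y h \<in> N} G"
proof -
  interpret N: normal N G by fact
  show ?thesis
  proof (rule subgroupI)
    have "commutator G y \<one> \<in> N" using assms by simp
    then show "{h \<in> carrier G. commutator G y h \<in> N} \<noteq> {}" by blast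
  next
    fix a assume a: "a \<in> {h \<in> carrier G. commutator G y h \<in> N}"
    have "commutator G y (inv a) = inv a \<otimes> inv (commutator G y a) \<otimes> a"
      using a assms by (simp add: inv_mult_group m_assoc)
    moreover have "inv a \<otimes> inv (commutator G y a) \<otimes> a \<in> N"
      using a by (intro N.inv_op_closed1) auto
    ultimately show "inv a \<in> {h \<in> carrier G. commutator G y h \<in> N}" using a by simp
  next
    fix a b assume ab: "a \<in> {h \<in> carrier G. commutator G y h \<in> N}"
      "b \<in> {h \<in> carrier G. commutator G y h \<in> N}"
    have "commutator G y (a \<otimes> b) = commutator G y a \<otimes> (a \<otimes> commutator G y b \<otimes> inv a)"
      using ab assms by (simp add: inv_mult_group m_assoc)
    moreover have "a \<otimes> commutator G y b \<otimes> inv a \<in> N"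
      using ab by (intro N.inv_op_closed2) auto
    ultimately show "a \<otimes> b \<in> {h \<in> carrier G. commutator G y h \<in> N}" using ab by simp
  qed auto
qed

lemma commutator_mem_swap:
  assumes "subgroup N G" "x \<in> carrier G" "y \<in> carrier G"
  shows "commutator G x y \<in> N \<longleftrightarrow> commutator G y x \<in> N"
  using assms inv_commutator[of x y] inv_commutator[of y x] subgroup.m_inv_closed[of N G] by metis

lemma subgroup_centralizer_elem:
  assumes "x \<in> carrier G"
  shows "subgroup (centralizer_elem G x) G"
proof -
  have "centralizer_elem G x = {h \<in> carrier G. commutator G x h \<in> {\<one>}}"
    using assms by (auto simp: centralizer_elem_def commutator_eq_one_iff)
  then show ?thesis using commutator_subgroup[OF one_is_normal assms] by simp
qed

text \<open>\<open>f\<close> is constant on left cosets of \<open>D\<close>. Translating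
  \<open>D\<close> by one chosen preimage per value gives disjoint cosets inside
  \<open>G\<close>.\<close>

lemma card_image_mult_le:
  assumes "subgroup D G" "finite (carrier G)"
    and "\<And>g d. g \<in> carrier G \<Longrightarrow> d \<in> D \<Longrightarrow> f (g \<otimes> d) = f g"
  shows "card (f ` carrier G) * card D \<le> card (carrier G)"
proof -
  interpret D: subgroup D G by fact
  define s where "s = inv_into (carrier G) f"
  have s: "s i \<in> carrier G" "f (s i) = i" if "i \<in> f ` carrier G" for i
    using that by (auto simp: s_def inv_into_into f_inv_into_f)
  have "inj_on (\<lambda>(i, d). s i \<otimes> d) ((f ` carrier G) \<times> D)"
  proof (rule inj_onI, clarify)
    fix g d h e assume *: "g \<in> carrier G" "h \<in> carrier G" "d \<in> D" "e \<in> D"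
      "s (f g) \<otimes> d = s (f h) \<otimes> e"
    have "f (s (f g) \<otimes> d) = f g" "f (s (f h) \<otimes> e) = f h"
      using s[of "f g"] s[of "f h"] *(1-4) assms(3) by auto
    then have "f g = f h" using *(5) by simp
    then show "f g = f h \<and> d = e" using * s[of "f h"] by simp
  qed
  moreover have "(\<lambda>(i, d). s i \<otimes> d) ` ((f ` carrier G) \<times> D) \<subseteq> carrier G"
    using s by auto
  ultimately have "card ((f ` carrier G) \<times> D) \<le> card (carrier G)"
    using assms(2) by (rule card_inj_on_le)
  then show ?thesis by (simp add: card_cartesian_product)
qed

lemma ex_maximal_subgroup:
  assumes "subgroup M G" "M \<noteq> carrier G" "finite (carrier G)"
  shows "\<exists>L. maximal_subgroup L G \<and> M \<subseteq> L"
proof -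
  define S where "S = {L. subgroup L G \<and> L \<noteq> carrier G \<and> M \<subseteq> L}"
  have "S \<subseteq> Pow (carrier G)" by (auto simp: S_def dest: subgroup.subset)
  then have "finite S" using assms(3) by (meson finite_Pow_iff finite_subset)
  moreover have "M \<in> S" using assms by (simp add: S_def)
  ultimately obtain L where L: "L \<in> S" "M \<subseteq> L" "\<And>K. K \<in> S \<Longrightarrow> L \<subseteq> K \<Longrightarrow> K = L"
    using finite_has_maximal2[of S M] by metis
  then have "maximal_subgroup L G"
    unfolding maximal_subgroup_def S_def by blast
  with L show ?thesis by blast
qed

text \<open>If nothing avoided both, an \<open>h\<close> outside \<open>H\<close> would lie in
  \<open>L\<close> and an \<open>l\<close> outside \<open>L\<close> would lie in \<open>H\<close>;
  then \<open>h \<otimes> l\<close> lies in neither subgroup.\<close>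

lemma ex_not_in_two_subgroups:
  assumes "subgroup H G" "subgroup L G" "H \<noteq> carrier G" "L \<noteq> carrier G"
  shows "\<exists>x \<in> carrier G. x \<notin> H \<and> x \<notin> L"
proof (rule ccontr)
  assume *: "\<not> ?thesis"
  interpret H: subgroup H G using assms by simp
  interpret L: subgroup L G using assms by simp
  obtain h where h: "h \<in> carrier G" "h \<notin> H" using assms H.subset by blast
  obtain l where l: "l \<in> carrier G" "l \<notin> L" using assms L.subset by blast
  have hl: "h \<in> L" "l \<in> H" using h l * by auto
  have "h \<otimes> l \<in> H \<or> h \<otimes> l \<in> L" using h l * by auto
  then show False
  proof
    assume "h \<otimes> l \<in> H"
    then have "h \<otimes> l \<otimes> inv l \<in> H" using hl by blast
    then show False using h l by (simp add: m_assoc)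
  next
    assume "h \<otimes> l \<in> L"
    then have "inv h \<otimes> (h \<otimes> l) \<in> L" using hl by blast
    then show False using h l by simp
  qed
qed

end

section \<open>Orbits and fixed points of p-groups\<close>

lemma (in group_action) orbit_subset: "x \<in> E \<Longrightarrow> orbit G \<phi> x \<subseteq> E"
  unfolding orbit_def using element_image by auto

lemma (in group_action) orbit_eq:
  assumes "x \<in> E" "y \<in> orbit G \<phi> x"
  shows "orbit G \<phi> y = orbit G \<phi> x"
proof -
  have y: "y \<in> E" using assms orbit_subset by blast
  then have "x \<in> orbit G \<phi> y" using assms orbit_sym by blast
  then show ?thesis
    using orbit_trans[OF assms(1) y _ assms(2)] orbit_trans[OF y assms(1)]
      orbit_subset[OF y] orbit_subset[OF assms(1)] by blast
qed

text \<open>An orbit of a p-group that is not a single point has length divisible by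
  \<open>p\<close>. Hence \<open>p\<close> divides the number of fixed points in \<open>S\<close>,
  which is not zero and so exceeds one.\<close>

lemma (in group_action) ex_second_fixed_point:
  assumes p: "Factorial_Ring.prime p" and G: "card (carrier G) = p ^ a"
    and S: "S \<subseteq> E" "finite S" "\<And>x. x \<in> S \<Longrightarrow> orbit G \<phi> x \<subseteq> S" "p dvd card S"
    and x: "x \<in> S" "orbit G \<phi> x = {x}"
  shows "\<exists>y \<in> S. y \<noteq> x \<and> orbit G \<phi> y = {y}"
proof -
  define F where "F = {y \<in> S. orbit G \<phi> y = {y}}"
  define C where "C = orbit G \<phi> ` (S - F)"
  have self: "y \<in> orbit G \<phi> y" if "y \<in> S" for y
    using that S(1) orbit_refl by blast
  have eq: "orbit G \<phi> z = orbit G \<phi> y" if "y \<in> S" "z \<in> orbit G \<phi> y" for y z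
    using that S(1) orbit_eq by blast
  have UC: "\<Union>C = S - F"
  proof
    show "S - F \<subseteq> \<Union>C" using self by (auto simp: C_def)
    show "\<Union>C \<subseteq> S - F"
    proof
      fix z assume "z \<in> \<Union>C"
      then obtain y where y: "y \<in> S" "y \<notin> F" "z \<in> orbit G \<phi> y"
        by (auto simp: C_def)
      have "z \<in> S" using y S(3) by blast
      moreover have "z \<notin> F"
      proof
        assume "z \<in> F"
        then have "orbit G \<phi> y = {z}" using eq[OF y(1,3)] by (simp add: F_def)
        then show False using self[OF y(1)] y \<open>z \<in> F\<close> by auto
      qed
      ultimately show "z \<in> S - F" by simp
    qed
  qed
  have "p dvd card (\<Union>C)"
  proof (rule dvd_partition)
    show "finite (\<Union>C)" using UC S(2) by simp
    show "\<forall>c\<in>C. p dvd card c"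
    proof
      fix c assume "c \<in> C"
      then obtain y where y: "y \<in> S" "y \<notin> F" "c = orbit G \<phi> y"
        by (auto simp: C_def)
      have "card c * card (stabilizer G \<phi> y) = p ^ a"
        using orbit_stabilizer_theorem[of y] y S(1) G by (auto simp: Coset.order_def)
      then obtain i where "card c = p ^ i"
        using p by (metis dvd_triv_left divides_primepow_nat)
      moreover have "card c \<noteq> 1"
      proof
        assume "card c = 1"
        then obtain z where "c = {z}" by (auto simp: card_1_singleton_iff)
        then show False using self[OF y(1)] y by (auto simp: F_def)
      qed
      ultimately show "p dvd card c" by (cases i) auto
    qed
    show "\<forall>c1\<in>C. \<forall>c2\<in>C. c1 \<noteq> c2 \<longrightarrow> c1 \<inter> c2 = {}"
    proof (intro ballI impI)
      fix c1 c2 assume c: "c1 \<in> C" "c2 \<in> C" "c1 \<noteq> c2"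
      then obtain y z where yz: "y \<in> S" "c1 = orbit G \<phi> y" "z \<in> S" "c2 = orbit G \<phi> z"
        by (auto simp: C_def)
      show "c1 \<inter> c2 = {}"
      proof (rule ccontr)
        assume "c1 \<inter> c2 \<noteq> {}"
        then obtain w where "w \<in> orbit G \<phi> y" "w \<in> orbit G \<phi> z" using yz by blast
        then have "orbit G \<phi> y = orbit G \<phi> z" using eq yz(1,3) by metis
        then show False using yz(2,4) c(3) by simp
      qed
    qed
  qed
  moreover have "card S = card (S - F) + card F"
  proof -
    have "F \<subseteq> S" by (auto simp: F_def)
    then show ?thesis
      using card_Diff_subset[of F S] card_mono[of S F] S(2) finite_subset[of F S] by simp
  qed
  ultimately have pF: "p dvd card F" using S(4) UC by (metis dvd_add_right_iff)
  have "\<not> F \<subseteq> {x}"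
  proof
    assume "F \<subseteq> {x}"
    then have "F = {x}" using x by (auto simp: F_def)
    then show False using pF p by auto
  qed
  then show ?thesis by (auto simp: F_def)
qed

section \<open>Maximal subgroups of p-groups: normality and index\<close>

context group
begin

text \<open>A maximal subgroup that is not normal is its own stabilizer under conjugation. The number of
  its conjugates is divisible by \<open>p\<close>, so it fixes a second conjugate, whose stabilizer is also the
  conjugate itself.\<close>

lemma maximal_subgroup_normal:
  assumes M: "maximal_subgroup M G" and p: "Factorial_Ring.prime p" and G: "card (carrier G) = p ^ a"
  shows "M \<lhd> G"
proof (rule ccontr)
  assume nn: "\<not> M \<lhd> G"
  have fin: "finite (carrier G)"
    using G p by (metis card_ge_0_finite prime_gt_0_nat zero_less_power)
  define c where "c = (\<lambda>g. \<lambda>H \<in> {H. subgroup H G}. g <# H #> (inv g))"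
  interpret act: group_action G "{H. subgroup H G}" c
    unfolding c_def by (rule action_by_conjugation_on_subgroups_set)
  have sM: "subgroup M G" using M by (simp add: maximal_subgroup_def)
  interpret M: subgroup M G by (rule sM)
  interpret actM: group_action "G\<lparr>carrier := M\<rparr>" "{H. subgroup H G}" c
    by (rule act.induced_action[OF sM])
  \<comment> \<open>The stabilizer of a subgroup is its normalizer, so it contains the
    subgroup.\<close>
  have stab_self: "H \<subseteq> stabilizer G c H" if "subgroup H G" for H
  proof
    fix h assume h: "h \<in> H"
    interpret H: subgroup H G by fact
    have "h <# H #> inv h = H"
      using h that coset_join3[of h H] coset_join2[of "inv h" H] by simp
    then show "h \<in> stabilizer G c H" using h that by (simp add: stabilizer_def c_def)
  qed
  have stM: "stabilizer G c M = M"
  proof -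
    have "stabilizer G c M \<noteq> carrier G"
    proof
      assume s: "stabilizer G c M = carrier G"
      have "g \<otimes> h \<otimes> inv g \<in> M" if "g \<in> carrier G" "h \<in> M" for g h
      proof -
        have "g <# M #> inv g = M" using s that sM by (auto simp: stabilizer_def c_def)
        moreover have "g \<otimes> h \<otimes> inv g \<in> g <# M #> inv g"
          using that by (auto simp: l_coset_def r_coset_def)
        ultimately show ?thesis by simp
      qed
      then show False using nn sM by (simp add: normal_inv_iff)
    qed
    then show ?thesis using M stab_self[OF sM] act.stabilizer_subgroup[of M] sM
      by (auto simp: maximal_subgroup_def)
  qed
  define S where "S = orbit G c M"
  have Ssub: "subgroup H G \<and> card H = card M" if "H \<in> S" for H
  proof -
    obtain g where g: "g \<in> carrier G" "H = c g M" using \<open>H \<in> S\<close> by (auto simp: S_def orbit_def)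
    have "subgroup H G" using act.element_image[of g M H] g sM by simp
    moreover have "H = (\<lambda>h. g \<otimes> h \<otimes> inv g) ` M"
      using g sM by (auto simp: c_def l_coset_def r_coset_def)
    moreover have "inj_on (\<lambda>h. g \<otimes> h \<otimes> inv g) M"
      using g by (auto intro!: inj_onI)
    ultimately show ?thesis by (simp add: card_image)
  qed
  have cM: "card S * card M = p ^ a" using act.orbit_stabilizer_theorem[of M] sM
    by (simp add: S_def stM Coset.order_def G)
  have ltM: "card M < p ^ a" using M M.subset fin G
    by (metis maximal_subgroup_def psubsetI psubset_card_mono)
  have pS: "p dvd card S"
  proof -
    obtain i where "card S = p ^ i"
      using cM p by (metis dvd_triv_left divides_primepow_nat)
    moreover have "card S \<noteq> 1" using cM ltM by auto
    ultimately show ?thesis by (cases i) auto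
  qed
  have finS: "finite S" using cM p by (metis card.infinite mult_0 power_not_zero not_prime_0)
  have orbS: "orbit G c H = S" if "H \<in> S" for H
    using that act.orbit_eq[of M H] sM by (simp add: S_def)
  obtain i where i: "card M = p ^ i" using cM p by (metis dvd_triv_right divides_primepow_nat)
  have "\<exists>H \<in> S. H \<noteq> M \<and> orbit (G\<lparr>carrier := M\<rparr>) c H = {H}"
  proof (rule actM.ex_second_fixed_point[OF p _ _ finS _ pS])
    show "card (carrier (G\<lparr>carrier := M\<rparr>)) = p ^ i" using i by simp
    show "S \<subseteq> {H. subgroup H G}" using Ssub by blast
    show "M \<in> S" using act.orbit_refl[of M] sM by (simp add: S_def)
    show "orbit (G\<lparr>carrier := M\<rparr>) c H \<subseteq> S" if "H \<in> S" for H
      using orbS[OF that] by (auto simp: orbit_def)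
    show "orbit (G\<lparr>carrier := M\<rparr>) c M = {M}"
    proof -
      have "c g M = M" if "g \<in> M" for g using stM that unfolding stabilizer_def by blast
      moreover have "M \<noteq> {}" using M.one_closed by blast
      ultimately have "(\<lambda>g. c g M) ` M = {M}" by (metis (no_types, lifting) image_cong image_constant_conv)
      then show ?thesis by (simp add: orbit_def Setcompr_eq_image)
    qed
  qed
  then obtain H where H: "H \<in> S" "H \<noteq> M" "orbit (G\<lparr>carrier := M\<rparr>) c H = {H}" by blast
  \<comment> \<open>\<open>H\<close> has the same orbit as \<open>M\<close>, hence a stabilizer of
    order \<open>card M = card H\<close>; as it contains \<open>H\<close>, it equals
    \<open>H\<close>.\<close>
  have "card S * card (stabilizer G c H) = card S * card M"
    using act.orbit_stabilizer_theorem[of H] Ssub[OF H(1)] orbS[OF H(1)] cM by (simp add: Coset.order_def G)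
  moreover have "card S \<noteq> 0" using cM p by (metis mult_0 not_prime_0 power_not_zero)
  ultimately have "card (stabilizer G c H) = card H" using Ssub[OF H(1)] by simp
  moreover have "finite (stabilizer G c H)"
    using fin act.stabilizer_subset finite_subset by metis
  ultimately have "stabilizer G c H = H"
    using stab_self[of H] Ssub[OF H(1)] by (metis card_subset_eq)
  \<comment> \<open>\<open>M\<close> fixes \<open>H\<close> and therefore lies in the stabilizer of
    \<open>H\<close>, which is \<open>H\<close>.\<close>
  moreover have "M \<subseteq> stabilizer G c H"
    using H(3) by (auto simp: orbit_def stabilizer_def)
  ultimately have "M = H" using Ssub[OF H(1)] fin
    by (metis card_subset_eq finite_subset subgroup.subset)
  then show False using H by simp
qed

text \<open>The first Sylow theorem gives a subgroup of order \<open>p\<close> in the nontrivial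
  p-group \<open>G Mod M\<close>. Its preimage is strictly larger than \<open>M\<close>, hence all
  of \<open>G\<close>.\<close>

lemma card_maximal_subgroup:
  assumes M: "maximal_subgroup M G" and p: "Factorial_Ring.prime p" and G: "card (carrier G) = p ^ a"
  shows "card (carrier G) = p * card M"
proof -
  have fin: "finite (carrier G)"
    using G p by (metis card_ge_0_finite prime_gt_0_nat zero_less_power)
  interpret M: normal M G by (rule maximal_subgroup_normal[OF assms])
  have lag: "card (rcosets M) * card M = p ^ a"
    using lagrange[of M] M.subgroup_axioms by (simp add: Coset.order_def G)
  have finM: "finite M" using fin M.subset finite_subset by blast
  have cM: "card M > 0" using finM M.one_closed card_gt_0_iff by blast
  obtain i where i: "card (rcosets M) = p ^ i"
    using lag p by (metis dvd_triv_left divides_primepow_nat)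
  have "i \<noteq> 0"
  proof
    assume "i = 0"
    then have "card M = card (carrier G)" using lag i G by simp
    then show False using M fin M.subset by (metis card_subset_eq maximal_subgroup_def)
  qed
  then obtain j where j: "card (rcosets M) = p ^ 1 * p ^ j" using i by (cases i) auto
  interpret Q: group "G Mod M" by (rule M.factorgroup_is_group)
  have finQ: "finite (rcosets M)" using j p by (metis card.infinite mult_is_0 not_prime_0 power_not_zero)
  have "\<exists>S. subgroup S (G Mod M) \<and> card S = p ^ 1"
    by (rule sylow_thm[OF p Q.group_axioms, of 1 "p ^ j"])
       (use j finQ in \<open>simp_all add: Coset.order_def FactGroup_def\<close>)
  then obtain S where S: "subgroup S (G Mod M)" "card S = p" by auto
  have Ssub: "S \<subseteq> rcosets M" using subgroup.subset[OF S(1)] by (simp add: FactGroup_def)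
  \<comment> \<open>\<open>\<Union>S\<close> is the preimage of \<open>S\<close> under the quotient
    map.\<close>
  have sU: "subgroup (\<Union>S) G" by (rule M.factgroup_subgroup_union_subgroup[OF S(1)])
  have "card M * card S = card (\<Union>S)"
  proof (rule card_partition)
    show "finite S" using Ssub finQ finite_subset by blast
    show "finite (\<Union>S)" using sU fin finite_subset subgroup.subset by blast
    show "card c = card M" if "c \<in> S" for c
      using that Ssub card_rcosets_equal[of c M] M.subset by auto
    show "c1 \<inter> c2 = {}" if "c1 \<in> S" "c2 \<in> S" "c1 \<noteq> c2" for c1 c2
      using that Ssub rcos_disjoint[OF M.subgroup_axioms] unfolding pairwise_def disjnt_def by blast
  qed
  then have cU: "card (\<Union>S) = p * card M" using S by (simp add: mult.commute)
  have "M \<in> S" using subgroup.one_closed[OF S(1)] by simp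
  then have "M \<subseteq> \<Union>S" by blast
  moreover have "\<Union>S \<noteq> M"
  proof
    assume "\<Union>S = M"
    then have "card M = p * card M" using cU by simp
    then show False using cM prime_gt_1_nat[OF p] by simp
  qed
  ultimately have "\<Union>S = carrier G" using M sU by (auto simp: maximal_subgroup_def)
  then show ?thesis using cU by simp
qed

section \<open>The derived subgroup and commutators with one element\<close>

text \<open>On the abelian normal subgroup \<open>A\<close> the map from \<open>a\<close> to
  \<open>[a, v]\<close> is a homomorphism, so its image \<open>I\<close> is a subgroup. It is
  normal, and modulo \<open>I\<close> the generators of \<open>G\<close>, namely \<open>v\<close>
  and the elements of \<open>A\<close>, commute; so \<open>I\<close> contains every
  commutator.\<close>

lemma derived_subset_commutators:
  assumes A: "A \<lhd> G" and comm: "\<And>a b. a \<in> A \<Longrightarrow> b \<in> A \<Longrightarrow> a \<otimes> b = b \<otimes> a"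
    and v: "v \<in> carrier G"
    and gen: "\<And>H. subgroup H G \<Longrightarrow> A \<subseteq> H \<Longrightarrow> v \<in> H \<Longrightarrow> H = carrier G"
  shows "derived G (carrier G) \<subseteq> (\<lambda>a. commutator G a v) ` A"
proof -
  interpret A: normal A G by (rule A)
  define I where "I = (\<lambda>a. commutator G a v) ` A"
  have IA: "I \<subseteq> A"
  proof
    fix x assume "x \<in> I"
    then obtain a where a: "a \<in> A" "x = commutator G a v" by (auto simp: I_def)
    have "x = a \<otimes> (v \<otimes> inv a \<otimes> inv v)" using a v by (simp add: m_assoc)
    moreover have "v \<otimes> inv a \<otimes> inv v \<in> A" using a v by (intro A.inv_op_closed2) auto
    ultimately show "x \<in> A" using a by simp
  qed
  \<comment> \<open>\<open>[ab, v] = a [b, v] (v a^-1 v^-1)\<close>, where \<open>[b, v]\<close>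
    lies in \<open>A\<close> and can be moved past \<open>a\<close>.\<close>
  have cmult: "commutator G (a \<otimes> b) v = commutator G a v \<otimes> commutator G b v"
    if "a \<in> A" "b \<in> A" for a b
  proof -
    have "commutator G b v \<in> A" using IA that by (auto simp: I_def)
    then have "a \<otimes> commutator G b v = commutator G b v \<otimes> a" using comm that by blast
    moreover have "commutator G (a \<otimes> b) v = a \<otimes> commutator G b v \<otimes> (v \<otimes> inv a \<otimes> inv v)"
      using that v by (simp add: m_assoc inv_mult_group)
    ultimately have "commutator G (a \<otimes> b) v = commutator G b v \<otimes> commutator G a v"
      using that v by (simp add: m_assoc)
    also have "\<dots> = commutator G a v \<otimes> commutator G b v"
      using IA that by (intro comm) (auto simp: I_def)
    finally show ?thesis .
  qed
  have sI: "subgroup I G"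
  proof (rule subgroupI)
    show "I \<subseteq> carrier G" using IA A.subset by blast
    show "I \<noteq> {}" using A.one_closed unfolding I_def by blast
  next
    fix x y assume "x \<in> I" "y \<in> I"
    then obtain a b where ab: "a \<in> A" "x = commutator G a v" "b \<in> A" "y = commutator G b v"
      by (auto simp: I_def)
    then have "x \<otimes> y = commutator G (a \<otimes> b) v" using cmult[of a b] by simp
    moreover have "a \<otimes> b \<in> A" using ab by simp
    ultimately show "x \<otimes> y \<in> I" unfolding I_def by blast
  next
    fix x assume "x \<in> I"
    then obtain a where a: "a \<in> A" "x = commutator G a v" by (auto simp: I_def)
    have "commutator G (inv a) v \<otimes> x = \<one>"
      using cmult[of "inv a" a] a v by simp
    then have "inv x = commutator G (inv a) v" using a v by (intro inv_equality) auto
    moreover have "inv a \<in> A" using a by simp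
    ultimately show "inv x \<in> I" unfolding I_def by blast
  qed
  interpret I: subgroup I G by (rule sI)
  \<comment> \<open>The normalizer of \<open>I\<close>; requiring conjugation by both
    \<open>g\<close> and its inverse makes closure under inverses immediate.\<close>
  have conj_I: "subgroup {g \<in> carrier G. \<forall>x \<in> I. g \<otimes> x \<otimes> inv g \<in> I \<and> inv g \<otimes> x \<otimes> g \<in> I} G" (is "subgroup ?N G")
  proof (rule subgroupI)
    show "?N \<noteq> {}" using I.mem_carrier by (auto intro!: exI[of _ \<one>])
  next
    fix g h assume gh: "g \<in> ?N" "h \<in> ?N"
    have "g \<otimes> h \<otimes> x \<otimes> inv (g \<otimes> h) \<in> I \<and> inv (g \<otimes> h) \<otimes> x \<otimes> (g \<otimes> h) \<in> I" if x: "x \<in> I" for x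
    proof -
      have "g \<otimes> h \<otimes> x \<otimes> inv (g \<otimes> h) = g \<otimes> (h \<otimes> x \<otimes> inv h) \<otimes> inv g"
        "inv (g \<otimes> h) \<otimes> x \<otimes> (g \<otimes> h) = inv h \<otimes> (inv g \<otimes> x \<otimes> g) \<otimes> h"
        using gh I.mem_carrier[OF x] by (simp_all add: m_assoc inv_mult_group)
      then show ?thesis using gh x by simp
    qed
    then show "g \<otimes> h \<in> ?N" using gh by simp
  qed auto
  \<comment> \<open>\<open>A\<close> centralizes \<open>I\<close>, and conjugating
    \<open>[a, v]\<close> by \<open>v\<close> gives the commutator of the conjugate of
    \<open>a\<close> with \<open>v\<close>; so the normalizer contains generators of
    \<open>G\<close>.\<close>
  have "?N = carrier G"
  proof (rule gen[OF conj_I])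
    show "A \<subseteq> ?N"
    proof
      fix a assume a: "a \<in> A"
      have "a \<otimes> x \<otimes> inv a = x" "inv a \<otimes> x \<otimes> a = x" if x: "x \<in> I" for x
      proof -
        have "x \<in> A" using x IA by blast
        then have ax: "a \<otimes> x = x \<otimes> a" "a \<in> carrier G" "x \<in> carrier G"
          using a by (auto intro: comm)
        then show "a \<otimes> x \<otimes> inv a = x" by (simp only: ax) (simp add: ax m_assoc)
        have "inv a \<otimes> x \<otimes> a = inv a \<otimes> (a \<otimes> x)" unfolding ax(1) using ax(2,3) by (simp add: m_assoc)
        then show "inv a \<otimes> x \<otimes> a = x" using ax(2,3) by simp
      qed
      then show "a \<in> ?N" using a by simp
    qed
    have "v \<otimes> x \<otimes> inv v \<in> I \<and> inv v \<otimes> x \<otimes> v \<in> I" if x: "x \<in> I" for x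
    proof -
      obtain a where a: "a \<in> A" "x = commutator G a v" using x by (auto simp: I_def)
      have "v \<otimes> x \<otimes> inv v = commutator G (v \<otimes> a \<otimes> inv v) v"
        "inv v \<otimes> x \<otimes> v = commutator G (inv v \<otimes> a \<otimes> v) v"
        using a v by (simp_all add: m_assoc inv_mult_group)
      moreover have "v \<otimes> a \<otimes> inv v \<in> A" "inv v \<otimes> a \<otimes> v \<in> A"
        using a v A.inv_op_closed1 A.inv_op_closed2 by auto
      ultimately show ?thesis unfolding I_def by blast
    qed
    then show "v \<in> ?N" using v by simp
  qed
  then have nI: "I \<lhd> G" using sI by (auto simp: normal_inv_iff)
  have swap: "commutator G x y \<in> I \<longleftrightarrow> commutator G y x \<in> I"
    if "x \<in> carrier G" "y \<in> carrier G" for x y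
    by (rule commutator_mem_swap[OF sI that])
  \<comment> \<open>The elements commuting with \<open>g\<close> modulo \<open>I\<close> form a
    subgroup, so testing \<open>v\<close> and \<open>A\<close> suffices. This is applied to
    \<open>v\<close>, then to elements of \<open>A\<close>, and last to an arbitrary
    element.\<close>
  have all: "\<forall>h \<in> carrier G. commutator G g h \<in> I"
    if "g \<in> carrier G" "commutator G g v \<in> I" "\<forall>a \<in> A. commutator G g a \<in> I" for g
    using gen[OF commutator_subgroup[OF nI that(1)]] that v A.subset by blast
  have av: "commutator G a v \<in> I" if "a \<in> A" for a using that by (auto simp: I_def)
  have 1: "commutator G g v \<in> I" if "g \<in> carrier G" for g
    using all[OF v] swap[OF that v] swap[OF v] av that v by (auto simp: m_assoc)
  have 2: "commutator G g a \<in> I" if "g \<in> carrier G" "a \<in> A" for g a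
  proof -
    have "commutator G a b \<in> I" if "b \<in> A" for b
      using commutator_eq_one_iff[of a b] comm[of a b] that \<open>a \<in> A\<close> by simp
    then show ?thesis using all[of a] swap[of g a] av that by auto
  qed
  have "commutator G g h \<in> I" if "g \<in> carrier G" "h \<in> carrier G" for g h
    using all[OF that(1)] 1 2 that by blast
  then have "derived_set G (carrier G) \<subseteq> I" by blast
  then have "derived G (carrier G) \<subseteq> I"
    unfolding derived_def using sI by (rule generate_subgroup_incl)
  then show ?thesis by (simp add: I_def)
qed

text \<open>In \<open>G Mod N\<close> the image of \<open>M\<close> is abelian and normal, and
  generates together with the image of \<open>w\<close>; so the derived subgroup there consists of
  commutators with the image of \<open>w\<close>. Thus the cosets \<open>N [a, w]\<close> with
  \<open>a \<in> M\<close> cover the derived subgroup of \<open>G\<close>.\<close>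

lemma card_derived_le:
  assumes fin: "finite (carrier G)" and M: "M \<lhd> G" and N: "N \<lhd> G" "N \<subseteq> M"
    and comm: "\<And>a b. a \<in> M \<Longrightarrow> b \<in> M \<Longrightarrow> commutator G a b \<in> N"
    and w: "w \<in> carrier G"
    and gen: "\<And>H. subgroup H G \<Longrightarrow> M \<subseteq> H \<Longrightarrow> w \<in> H \<Longrightarrow> H = carrier G"
  shows "card (derived G (carrier G)) \<le> card N * card ((\<lambda>a. N #> commutator G a w) ` M)"
proof -
  interpret M: normal M G by (rule M)
  interpret N: normal N G by (rule N)
  define f where "f = (\<lambda>a. N #> a)"
  interpret Q: group "G Mod N" by (rule N.factorgroup_is_group)
  interpret f: group_hom G "G Mod N" f
    unfolding f_def using N.r_coset_hom_Mod by unfold_locales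
  have surj: "f ` carrier G = carrier (G Mod N)" by (simp add: f_def carrier_FactGroup)
  have f_comm: "f (commutator G a b) = commutator (G Mod N) (f a) (f b)"
    if "a \<in> carrier G" "b \<in> carrier G" for a b
    using that by (simp only: f.hom_mult f.hom_inv m_closed inv_closed)
  have f_one: "f x = \<one>\<^bsub>G Mod N\<^esub> \<longleftrightarrow> x \<in> N" if x: "x \<in> carrier G" for x
  proof
    assume "f x = \<one>\<^bsub>G Mod N\<^esub>"
    then have "N #> x = N" by (simp add: f_def)
    then show "x \<in> N" by (rule coset_join1[OF _ x N.subgroup_axioms])
  next
    assume "x \<in> N"
    then show "f x = \<one>\<^bsub>G Mod N\<^esub>" by (simp add: f_def coset_join2[OF x N.subgroup_axioms])
  qed
  have "derived (G Mod N) (carrier (G Mod N)) \<subseteq> (\<lambda>a. commutator (G Mod N) a (f w)) ` (f ` M)"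
  proof (rule Q.derived_subset_commutators)
    show "f ` M \<lhd> G Mod N" using M.surj_hom_normal_subgroup[OF f.group_hom_axioms surj] .
    show "f w \<in> carrier (G Mod N)" by (rule f.hom_closed[OF w])
    show "x \<otimes>\<^bsub>G Mod N\<^esub> y = y \<otimes>\<^bsub>G Mod N\<^esub> x" if xy: "x \<in> f ` M" "y \<in> f ` M" for x y
    proof -
      obtain a b where ab: "a \<in> M" "x = f a" "b \<in> M" "y = f b" using xy by blast
      have abG: "a \<in> carrier G" "b \<in> carrier G" by (rule M.mem_carrier, fact)+
      have "commutator (G Mod N) x y = f (commutator G a b)"
        unfolding ab(2,4) by (rule f_comm[OF abG, symmetric])
      also have "\<dots> = \<one>\<^bsub>G Mod N\<^esub>"
        by (rule f_one[THEN iffD2, OF _ comm[OF ab(1,3)]]) (use abG in simp)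
      finally show ?thesis
        using Q.commutator_eq_one_iff[OF f.hom_closed[OF abG(1)] f.hom_closed[OF abG(2)]]
        unfolding ab(2,4) by (rule iffD1[rotated])
    qed
    fix H assume H: "subgroup H (G Mod N)" "f ` M \<subseteq> H" "f w \<in> H"
    have "subgroup (\<Union>H) G" by (rule N.factgroup_subgroup_union_subgroup[OF H(1)])
    moreover have UH: "\<Union>H = {x \<in> carrier G. f x \<in> H}"
      using N.factgroup_subgroup_union_char[OF H(1)] by (simp add: f_def)
    ultimately have "\<Union>H = carrier G" using gen[of "\<Union>H"] H(2,3) w M.subset by blast
    then have "f ` carrier G \<subseteq> H" using UH by blast
    then show "H = carrier (G Mod N)" using surj subgroup.subset[OF H(1)] by simp
  qed
  then have "f ` derived G (carrier G) \<subseteq> (\<lambda>a. commutator (G Mod N) (f a) (f w)) ` M"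
    using f.derived_img[of "carrier G"] surj by (simp add: image_image del: mult_FactGroup)
  also have "\<dots> = (\<lambda>a. N #> commutator G a w) ` M"
    using f_comm w by (intro image_cong) (auto simp: f_def)
  finally have sub: "f ` derived G (carrier G) \<subseteq> (\<lambda>a. N #> commutator G a w) ` M" (is "_ \<subseteq> ?I") .
  have "derived G (carrier G) \<subseteq> \<Union>?I"
  proof
    fix x assume x: "x \<in> derived G (carrier G)"
    then have "x \<in> carrier G" using derived_in_carrier by blast
    then have "x \<in> f x" using rcos_self[OF _ N.subgroup_axioms] by (simp add: f_def)
    then show "x \<in> \<Union>?I" using sub x by blast
  qed
  moreover have I: "?I \<subseteq> rcosets N" using w by (auto intro!: rcosetsI N.subset)
  then have "\<Union>?I \<subseteq> carrier G" using rcosets_part_G[OF N.subgroup_axioms] by blast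
  then have finU: "finite (\<Union>?I)" using fin finite_subset by blast
  ultimately have "card (derived G (carrier G)) \<le> card (\<Union>?I)" by (intro card_mono)
  also have "\<dots> = card N * card ?I"
  proof (rule card_partition[symmetric])
    show "finite ?I" using fin M.subset finite_subset by blast
    show "card c = card N" if "c \<in> ?I" for c
      using that I card_rcosets_equal[of c N] N.subset by auto
    show "c1 \<inter> c2 = {}" if "c1 \<in> ?I" "c2 \<in> ?I" "c1 \<noteq> c2" for c1 c2
      using that I rcos_disjoint[OF N.subgroup_axioms] unfolding pairwise_def disjnt_def by blast
  qed (rule finU)
  finally show ?thesis .
qed

section \<open>Configurations of several maximal subgroups\<close>

lemma maximal_subgroup_sub: "maximal_subgroup M G \<Longrightarrow> subgroup M G"
  and maximal_subgroup_neq: "maximal_subgroup M G \<Longrightarrow> M \<noteq> carrier G"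
  and maximal_subgroup_cases:
    "maximal_subgroup M G \<Longrightarrow> subgroup L G \<Longrightarrow> M \<subseteq> L \<Longrightarrow> L = M \<or> L = carrier G"
  by (simp_all add: maximal_subgroup_def)

lemma maximal_subgroup_subset_eq:
  assumes "maximal_subgroup M G" "maximal_subgroup L G" "M \<subseteq> L"
  shows "M = L"
  using assms by (metis maximal_subgroup_def)

text \<open>Otherwise \<open>D\<close> and the subgroup generated by its complement would be two
  proper subgroups covering \<open>G\<close>.\<close>

lemma generate_Diff:
  assumes "subgroup D G" "D \<noteq> carrier G"
  shows "generate G (carrier G - D) = carrier G"
proof (rule ccontr)
  assume *: "generate G (carrier G - D) \<noteq> carrier G"
  have "subgroup (generate G (carrier G - D)) G" by (intro generate_is_subgroup) auto
  then obtain x where "x \<in> carrier G" "x \<notin> D" "x \<notin> generate G (carrier G - D)"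
    using ex_not_in_two_subgroups[OF assms(1) _ assms(2) *] by blast
  then show False by (auto intro: generate.incl)
qed

text \<open>An element of \<open>M \<inter> A2\<close> outside \<open>A1\<close> would give
  \<open>A1 (M \<inter> A2) = G\<close>. By the modular law
  \<open>A2 = (A1 \<inter> A2) (M \<inter> A2)\<close>, which lies in \<open>M\<close>, against
  \<open>M \<noteq> A2\<close>.\<close>

lemma Int_maximal_subgroup_subset:
  assumes A1: "maximal_subgroup A1 G" "A1 \<lhd> G" and A2: "maximal_subgroup A2 G"
    and M: "maximal_subgroup M G" "A1 \<inter> A2 \<subseteq> M" "M \<noteq> A2"
  shows "M \<inter> A2 \<subseteq> A1"
proof
  fix g assume g: "g \<in> M \<inter> A2"
  interpret A2: subgroup A2 G using A2 by (rule maximal_subgroup_sub)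
  interpret M: subgroup M G using M(1) by (rule maximal_subgroup_sub)
  interpret A1: normal A1 G by (rule A1(2))
  have sMA: "subgroup (M \<inter> A2) G" using M.subgroup_axioms A2.subgroup_axioms subgroups_Inter_pair by blast
  have sP: "subgroup (A1 <#> (M \<inter> A2)) G" by (rule mult_norm_subgroup[OF A1(2) sMA])
  show "g \<in> A1"
  proof (rule ccontr)
    assume "g \<notin> A1"
    have sub: "A1 \<subseteq> A1 <#> (M \<inter> A2)"
    proof
      fix a assume "a \<in> A1"
      then have "a = a \<otimes> \<one>" "\<one> \<in> M \<inter> A2" by auto
      then show "a \<in> A1 <#> (M \<inter> A2)" using \<open>a \<in> A1\<close> unfolding set_mult_def by blast
    qed
    have "g = \<one> \<otimes> g" using g by simp
    then have "g \<in> A1 <#> (M \<inter> A2)" using g A1.one_closed unfolding set_mult_def by blast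
    then have all: "A1 <#> (M \<inter> A2) = carrier G"
      using maximal_subgroup_cases[OF A1(1) sP sub] \<open>g \<notin> A1\<close> by blast
    have "A2 \<subseteq> M"
    proof
      fix a assume a: "a \<in> A2"
      then have "a \<in> A1 <#> (M \<inter> A2)" using all by simp
      then obtain b e where be: "b \<in> A1" "e \<in> M \<inter> A2" "a = b \<otimes> e" unfolding set_mult_def by blast
      have "b = a \<otimes> inv e" using be by (simp add: m_assoc)
      moreover have "a \<otimes> inv e \<in> A2" using a be by (intro A2.m_closed A2.m_inv_closed) auto
      ultimately have "b \<in> A2" by simp
      then have "b \<in> M" using be M(2) by blast
      then show "a \<in> M" using be by simp
    qed
    then show False using maximal_subgroup_subset_eq[OF A2 M(1)] M(3) by simp
  qed
qed

text \<open>Put the span of the complement of \<open>D \<union> E\<close> into a maximal subgroup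
  \<open>L\<close>, and \<open>D\<close> and \<open>E\<close> into maximal subgroups
  \<open>A\<close> and \<open>M\<close>. Then \<open>A\<close>, \<open>E\<close> and
  \<open>L\<close> cover \<open>G\<close>, which forces \<open>M \<subseteq> E\<close>.\<close>

lemma maximal_subgroup_if_not_generate:
  assumes p: "Factorial_Ring.prime p" and G: "card (carrier G) = p ^ a"
    and D: "subgroup D G" "D \<noteq> carrier G" and E: "subgroup E G" "E \<noteq> carrier G"
    and gen: "generate G (carrier G - (D \<union> E)) \<noteq> carrier G"
  shows "maximal_subgroup E G"
proof -
  have fin: "finite (carrier G)"
    using G p by (metis card_ge_0_finite prime_gt_0_nat zero_less_power)
  have "subgroup (generate G (carrier G - (D \<union> E))) G" by (intro generate_is_subgroup) auto
  then obtain L where L: "maximal_subgroup L G" "generate G (carrier G - (D \<union> E)) \<subseteq> L"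
    using ex_maximal_subgroup gen fin by blast
  obtain A where A: "maximal_subgroup A G" "D \<subseteq> A" using ex_maximal_subgroup D fin by blast
  obtain M where M: "maximal_subgroup M G" "E \<subseteq> M" using ex_maximal_subgroup E fin by blast
  note max = L(1) A(1) M(1)
  interpret L: normal L G using maximal_subgroup_normal[OF L(1) p G] .
  interpret A: normal A G using maximal_subgroup_normal[OF A(1) p G] .
  interpret M: normal M G using maximal_subgroup_normal[OF M(1) p G] .
  interpret E: subgroup E G by (rule E(1))
  have cover: "x \<in> A \<or> x \<in> E \<or> x \<in> L" if "x \<in> carrier G" for x
    using that L(2) A(2) generate.incl[of x "carrier G - (D \<union> E)" G] by blast
  obtain x where x: "x \<in> carrier G" "x \<notin> A" "x \<notin> L"
    using ex_not_in_two_subgroups[OF A.subgroup_axioms L.subgroup_axioms] max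
      maximal_subgroup_neq by metis
  have xE: "x \<in> E" using cover x by blast
  \<comment> \<open>Multiplying \<open>x\<close> by \<open>u\<close> in \<open>A \<inter> L\<close>
    keeps it outside \<open>A\<close> and \<open>L\<close>, so the product falls into
    \<open>E\<close>, and \<open>u\<close> with it.\<close>
  have AL: "A \<inter> L \<subseteq> E"
  proof
    fix u assume u: "u \<in> A \<inter> L"
    have "x = x \<otimes> u \<otimes> inv u" using x u by (simp add: m_assoc)
    then have "x \<otimes> u \<notin> A" "x \<otimes> u \<notin> L"
      using x u A.m_closed[OF _ A.m_inv_closed] L.m_closed[OF _ L.m_inv_closed] by (metis IntD1, metis IntD2)
    then have "x \<otimes> u \<in> E" using cover[of "x \<otimes> u"] x u by auto
    then have "inv x \<otimes> (x \<otimes> u) \<in> E" using xE by blast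
    then show "u \<in> E" using x u by simp
  qed
  \<comment> \<open>\<open>M\<close> differs from \<open>A\<close> and \<open>L\<close> and contains
    \<open>A \<inter> L\<close>; hence it meets each of them inside the other, thus inside
    \<open>E\<close>.\<close>
  have "A \<noteq> M" "L \<noteq> M" using x xE M(2) by auto
  then have "M \<inter> A \<subseteq> L" "M \<inter> L \<subseteq> A"
    using Int_maximal_subgroup_subset[OF max(1) L.normal_axioms max(2) max(3)]
      Int_maximal_subgroup_subset[OF max(2) A.normal_axioms max(1) max(3)] AL M(2) by blast+
  then have "M \<subseteq> E" using cover AL M.subset by blast
  then have "M = E" using M(2) by blast
  then show ?thesis using M(1) by simp
qed

text \<open>The quotient by a maximal subgroup has order \<open>p\<close>.\<close>

lemma pow_mem_maximal_subgroup:
  assumes "maximal_subgroup M G" and p: "Factorial_Ring.prime p" and G: "card (carrier G) = p ^ a"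
    and x: "x \<in> carrier G"
  shows "x [^] p \<in> M"
proof -
  interpret M: normal M G by (rule maximal_subgroup_normal[OF assms(1) p G])
  interpret Q: group "G Mod M" by (rule M.factorgroup_is_group)
  have "card (rcosets M) * card M = p * card M"
    using lagrange[of M] card_maximal_subgroup[OF assms(1) p G] M.subgroup_axioms
    by (simp add: Coset.order_def)
  moreover have "card M \<noteq> 0"
    using card_maximal_subgroup[OF assms(1) p G] G p by (metis mult_0_right not_prime_0 power_not_zero)
  ultimately have "Coset.order (G Mod M) = p" by (simp add: Coset.order_def FactGroup_def)
  then have "(M #> x) [^]\<^bsub>G Mod M\<^esub> p = \<one>\<^bsub>G Mod M\<^esub>"
    using Q.pow_order_eq_1[of "M #> x"] x by (auto simp: carrier_FactGroup)
  then have "M #> (x [^] p) = M" using M.FactGroup_pow[OF x] by simp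
  then show ?thesis using coset_join1[OF _ _ M.subgroup_axioms] x by simp
qed

text \<open>Enlarge \<open>H1\<close> and \<open>H2\<close> to maximal subgroups \<open>A\<close>
  and \<open>B\<close> and choose \<open>x\<close> outside both. If \<open>A \<noteq> B\<close>, a
  maximal \<open>M\<close> containing \<open>x\<close> and \<open>A \<inter> B\<close> satisfies
  \<open>M \<inter> B \<subseteq> A\<close>, so \<open>D = M \<inter> A\<close> works;
  \<open>x\<close> keeps it proper in \<open>M\<close>. If \<open>A = B\<close>, containing
  \<open>x\<close> is enough, and such an \<open>M\<close> exists because \<open>G\<close> is not
  cyclic.\<close>

lemma ex_maximal_subgroup_avoiding:
  assumes p: "Factorial_Ring.prime p" and G: "card (carrier G) = p ^ a"
    and H1: "subgroup H1 G" "H1 \<noteq> carrier G" and H2: "subgroup H2 G" "H2 \<noteq> carrier G"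
    and nc: "\<And>x. x \<in> carrier G \<Longrightarrow> generate G {x} \<noteq> carrier G"
  shows "\<exists>M D. maximal_subgroup M G \<and> subgroup D G \<and> D \<subseteq> M \<and> D \<noteq> M \<and> M \<inter> (H1 \<union> H2) \<subseteq> D"
proof -
  have fin: "finite (carrier G)"
    using G p by (metis card_ge_0_finite prime_gt_0_nat zero_less_power)
  obtain A where A: "maximal_subgroup A G" "H1 \<subseteq> A" using ex_maximal_subgroup H1 fin by blast
  obtain B where B: "maximal_subgroup B G" "H2 \<subseteq> B" using ex_maximal_subgroup H2 fin by blast
  interpret A: normal A G using maximal_subgroup_normal[OF A(1) p G] .
  interpret B: normal B G using maximal_subgroup_normal[OF B(1) p G] .
  obtain x where x: "x \<in> carrier G" "x \<notin> A" "x \<notin> B"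
    using ex_not_in_two_subgroups[OF A.subgroup_axioms B.subgroup_axioms] A(1) B(1)
      maximal_subgroup_neq by metis
  have sx: "subgroup (generate G {x}) G" using x by (intro generate_is_subgroup) auto
  have xx: "x \<in> generate G {x}" by (auto intro: generate.incl)
  have "\<exists>M. maximal_subgroup M G \<and> x \<in> M \<and> M \<inter> B \<subseteq> A"
  proof (cases "A = B")
    case True
    then show ?thesis using ex_maximal_subgroup[OF sx nc[OF x(1)] fin] xx by blast
  next
    case False
    define L where "L = (A \<inter> B) <#> generate G {x}"
    have nAB: "A \<inter> B \<lhd> G" using A.normal_axioms B.normal_axioms by (rule normal_subgroup_intersect)
    have sL: "subgroup L G" unfolding L_def by (rule mult_norm_subgroup[OF nAB sx])
    \<comment> \<open>If \<open>L = G\<close>, an element of \<open>A\<close> is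
      \<open>d x^i\<close> with \<open>x^i\<close> in \<open>A\<close>. As \<open>x^p\<close> lies
      in \<open>A\<close> and \<open>x\<close> does not, \<open>p\<close> divides \<open>i\<close>;
      since \<open>x^p\<close> also lies in \<open>B\<close>, so does the element. This gives
      \<open>A \<subseteq> B\<close>, hence \<open>A = B\<close>.\<close>
    have "L \<noteq> carrier G"
    proof
      assume L: "L = carrier G"
      have "A \<subseteq> B"
      proof
        fix a assume a: "a \<in> A"
        then have "a \<in> L" using L by simp
        then obtain d i where di: "d \<in> A \<inter> B" "a = d \<otimes> x [^] (i::int)"
          unfolding L_def set_mult_def generate_pow[OF x(1)] by blast
        have "x [^] i = inv d \<otimes> a" using di x by simp
        moreover have "inv d \<otimes> a \<in> A" using a di by (intro A.m_closed A.m_inv_closed) auto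
        ultimately have xi: "x [^] i \<in> A" by simp
        have xpn: "x [^] p \<in> A \<inter> B" using pow_mem_maximal_subgroup[OF _ p G x(1)] A(1) B(1) by blast
        then have xp: "x [^] int p \<in> A \<inter> B" by (simp add: int_pow_int)
        have "int p dvd i"
        proof (rule ccontr)
          assume "\<not> int p dvd i"
          then have "coprime (int p) i" using p by (simp add: prime_imp_coprime)
          then obtain u v where uv: "int p * u + i * v = 1"
            by (metis bezout_int coprime_imp_gcd_eq_1 mult.commute)
          have "x = (x [^] int p) [^] u \<otimes> (x [^] i) [^] v"
            using x uv by (simp add: int_pow_pow int_pow_mult[symmetric])
          moreover have "(x [^] int p) [^] u \<in> A" "(x [^] i) [^] v \<in> A"
            using xp xi subgroup_int_pow_closed[OF A.subgroup_axioms] by auto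
          ultimately show False using x(2) A.m_closed by metis
        qed
        then obtain j where "i = int p * j" by (elim dvdE)
        then have "x [^] i = (x [^] int p) [^] j" using x by (simp add: int_pow_pow)
        then have "x [^] i \<in> B" using xp subgroup_int_pow_closed[OF B.subgroup_axioms] by auto
        then show "a \<in> B" using di by simp
      qed
      then show False using maximal_subgroup_subset_eq[OF A(1) B(1)] False by simp
    qed
    then obtain M where M: "maximal_subgroup M G" "L \<subseteq> M" using ex_maximal_subgroup[OF sL _ fin] by blast
    have "A \<inter> B \<subseteq> L"
    proof
      fix d assume "d \<in> A \<inter> B"
      moreover have "\<one> \<in> generate G {x}" by (rule generate.one)
      ultimately show "d \<in> L" unfolding L_def set_mult_def by force
    qed
    moreover have "x \<in> L"
    proof -
      have "x = \<one> \<otimes> x" using x by simp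
      then show ?thesis using xx A.one_closed B.one_closed unfolding L_def set_mult_def by blast
    qed
    ultimately have "x \<in> M" "A \<inter> B \<subseteq> M" using M by auto
    then show ?thesis
      using Int_maximal_subgroup_subset[OF A(1) A.normal_axioms B(1) M(1)] x M(1) by blast
  qed
  then obtain M where M: "maximal_subgroup M G" "x \<in> M" "M \<inter> B \<subseteq> A" by blast
  have "subgroup (M \<inter> A) G"
    using maximal_subgroup_sub[OF M(1)] A.subgroup_axioms by (rule subgroups_Inter_pair)
  moreover have "M \<inter> A \<noteq> M" using M x by blast
  moreover have "M \<inter> (H1 \<union> H2) \<subseteq> M \<inter> A" using M A B by blast
  ultimately show ?thesis using M(1) by blast
qed

section \<open>Centralizers in subgroups\<close>

text \<open>Multiplication from \<open>L \<times> D\<close> to \<open>G\<close> has fibres of size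
  at most \<open>card (L \<inter> D)\<close>: dividing the first factor by that of a fixed pair
  embeds the fibre into the intersection.\<close>

lemma card_mult_le_card_Int:
  assumes L: "subgroup L G" and D: "subgroup D G" and fin: "finite (carrier G)"
  shows "card L * card D \<le> card (carrier G) * card (L \<inter> D)"
proof -
  interpret L: subgroup L G by (rule L)
  interpret D: subgroup D G by (rule D)
  define F where "F = (\<lambda>g. {(l, d) \<in> L \<times> D. l \<otimes> d = g})"
  have finLD: "finite L" "finite D" using fin L.subset D.subset finite_subset by blast+
  have "card (F g) \<le> card (L \<inter> D)" if g: "g \<in> carrier G" for g
  proof (cases "F g = {}")
    case False
    then obtain l d where ld: "l \<in> L" "d \<in> D" "l \<otimes> d = g" by (auto simp: F_def)
    have "inj_on (\<lambda>(x, y). inv l \<otimes> x) (F g)"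
    proof (rule inj_onI, clarify)
      fix x y x' y' assume *: "(x, y) \<in> F g" "(x', y') \<in> F g" "inv l \<otimes> x = inv l \<otimes> x'"
      then have "x \<in> carrier G" "x' \<in> carrier G" "y \<in> carrier G" "y' \<in> carrier G"
        "x \<otimes> y = x' \<otimes> y'" by (auto simp: F_def)
      then show "x = x' \<and> y = y'" using *(3) ld by simp
    qed
    moreover have "(\<lambda>(x, y). inv l \<otimes> x) ` F g \<subseteq> L \<inter> D"
    proof clarify
      fix x y assume "(x, y) \<in> F g"
      then have xy: "x \<in> L" "y \<in> D" "x \<otimes> y = l \<otimes> d" using ld by (auto simp: F_def)
      then have car: "x \<in> carrier G" "y \<in> carrier G" "l \<in> carrier G" "d \<in> carrier G"
        using ld by auto
      then have "inv l \<otimes> x = inv l \<otimes> (x \<otimes> y) \<otimes> inv y" by (simp add: m_assoc)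
      then have "inv l \<otimes> x = d \<otimes> inv y" using xy(3) car by simp
      moreover have "d \<otimes> inv y \<in> D" using ld xy by simp
      moreover have "inv l \<otimes> x \<in> L" using ld xy by simp
      ultimately show "inv l \<otimes> x \<in> L \<inter> D" by simp
    qed
    ultimately show ?thesis using finLD by (intro card_inj_on_le) auto
  qed simp
  then have "(\<Sum>g \<in> carrier G. card (F g)) \<le> of_nat (card (carrier G)) * card (L \<inter> D)"
    by (intro sum_bounded_above)
  moreover have "L \<times> D = (\<Union>g \<in> carrier G. F g)" by (auto simp: F_def)
  then have "card (L \<times> D) \<le> (\<Sum>g \<in> carrier G. card (F g))"
    using card_UN_le[OF fin, of F] by simp
  ultimately show ?thesis by (simp add: card_cartesian_product)
qed

lemma centralizer_elem_carrier_update: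
  "M \<subseteq> carrier G \<Longrightarrow> centralizer_elem (G\<lparr>carrier := M\<rparr>) y = M \<inter> centralizer_elem G y"
  by (auto simp: centralizer_elem_def)

text \<open>The product bound for \<open>M\<close> and the centralizer of \<open>y\<close> shows
  that the class of \<open>y\<close> in \<open>M\<close> is no larger than its class in
  \<open>G\<close>; \<open>c\<close> is any bound on the latter.\<close>

lemma breadth_subgroup_le:
  assumes M: "subgroup M G" and fin: "finite (carrier G)" and y: "y \<in> M"
    and le: "card (carrier G) \<le> c * card (centralizer_elem G y)"
  shows "card M \<le> c * card (M \<inter> centralizer_elem G y)"
proof -
  have yG: "y \<in> carrier G" using M y by (rule subgroup.mem_carrier)
  have sC: "subgroup (centralizer_elem G y) G" by (rule subgroup_centralizer_elem[OF yG])
  have finC: "finite (centralizer_elem G y)" using fin by (simp add: centralizer_elem_def)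
  then have pos: "card (centralizer_elem G y) > 0"
    using subgroup.one_closed[OF sC] card_gt_0_iff by blast
  have "card M * card (centralizer_elem G y) \<le> card (carrier G) * card (M \<inter> centralizer_elem G y)"
    by (rule card_mult_le_card_Int[OF M sC fin])
  also have "\<dots> \<le> c * card (centralizer_elem G y) * card (M \<inter> centralizer_elem G y)"
    using le by (rule mult_right_mono) simp
  also have "\<dots> = c * card (M \<inter> centralizer_elem G y) * card (centralizer_elem G y)" by simp
  finally show ?thesis using pos by simp
qed

text \<open>The elements commuting with \<open>y\<close> modulo \<open>N\<close> form a subgroup
  containing \<open>M\<close>. An element of the centralizer outside \<open>M\<close> would make
  this subgroup all of \<open>G\<close>, but \<open>w\<close> is not in it.\<close>

lemma centralizer_elem_subset_maximal_subgroup: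
  assumes M: "maximal_subgroup M G" and N: "N \<lhd> G"
    and comm: "\<And>a b. a \<in> M \<Longrightarrow> b \<in> M \<Longrightarrow> commutator G a b \<in> N"
    and y: "y \<in> M" and w: "w \<in> carrier G" "commutator G y w \<notin> N"
  shows "centralizer_elem G y \<subseteq> M"
proof (rule ccontr)
  interpret M: subgroup M G using M by (rule maximal_subgroup_sub)
  interpret N: normal N G by (rule N)
  assume "\<not> ?thesis"
  then obtain g where g: "g \<in> carrier G" "g \<otimes> y = y \<otimes> g" "g \<notin> M"
    by (auto simp: centralizer_elem_def)
  let ?K = "{h \<in> carrier G. commutator G y h \<in> N}"
  have "subgroup ?K G" using commutator_subgroup[OF N, of y] y by simp
  moreover have "M \<subseteq> ?K" using comm y by auto
  moreover have "g \<in> ?K" using g y commutator_eq_one_iff[of y g] N.one_closed by simp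
  ultimately have "?K = carrier G" using maximal_subgroup_cases[OF M, of ?K] g(3) by blast
  then show False using w by blast
qed

text \<open>In \<open>[ad, w] = (a [d, w] a^-1) [a, w]\<close> the first factor lies in
  \<open>N\<close>. This makes \<open>card_image_mult_le\<close> applicable to the map from
  \<open>a\<close> to \<open>N [a, w]\<close>.\<close>

lemma r_coset_commutator_mult:
  assumes N: "N \<lhd> G" and "a \<in> carrier G" "d \<in> carrier G" "w \<in> carrier G" "commutator G d w \<in> N"
  shows "N #> commutator G (a \<otimes> d) w = N #> commutator G a w"
proof -
  interpret N: normal N G by (rule N)
  have eq: "commutator G (a \<otimes> d) w = (a \<otimes> commutator G d w \<otimes> inv a) \<otimes> commutator G a w"
    using assms by (simp add: m_assoc inv_mult_group)
  have n: "a \<otimes> commutator G d w \<otimes> inv a \<in> N" using assms by (intro N.inv_op_closed2)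
  have "N #> commutator G (a \<otimes> d) w = N #> (a \<otimes> commutator G d w \<otimes> inv a) #> commutator G a w"
    unfolding eq using assms by (intro coset_mult_assoc[symmetric] N.subset) auto
  also have "N #> (a \<otimes> commutator G d w \<otimes> inv a) = N"
    using n by (intro coset_join2 N.subgroup_axioms) auto
  finally show ?thesis .
qed

lemma derived_cyclic:
  assumes x: "x \<in> carrier G" "generate G {x} = carrier G"
  shows "derived G (carrier G) = {\<one>}"
proof -
  have "y \<otimes> z = z \<otimes> y" if yz: "y \<in> carrier G" "z \<in> carrier G" for y z
  proof -
    obtain i j :: int where "y = x [^] i" "z = x [^] j"
      using yz generate_pow[OF x(1)] x(2) by blast
    then show ?thesis using x(1) by (simp add: int_pow_mult[symmetric] add.commute)
  qed
  then interpret comm_group G by (intro group_comm_groupI)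
  show ?thesis by (rule derived_eq_singleton) simp
qed

end

section \<open>The induction on the group order\<close>

lemma (in group) generate_eq_carrier_mono:
  assumes "generate G A = carrier G" "A \<subseteq> B" "B \<subseteq> carrier G"
  shows "generate G B = carrier G"
  using mono_generate[OF assms(2)] generate_incl[OF assms(3)] assms(1) by simp

text \<open>Breadth at most \<open>j\<close> is expressed by \<open>|G| \<le> p\<^sup>j |C(x)|\<close>.
  The exponent \<open>0\<close> for \<open>m = 0\<close> is needed for the induction: when \<open>m = 1\<close> and
  \<open>|M : E| = p\<close>, the hypothesis for \<open>M\<close> must yield that \<open>M\<close> is abelian.\<close>

lemma card_derived_bound:
  fixes G :: "('a, 'b) monoid_scheme"
  assumes "group G" and p: "Factorial_Ring.prime p" and "card (carrier G) = p ^ a" and "m \<le> k"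
    and "subgroup H1 G" "H1 \<noteq> carrier G" "subgroup H2 G" "H2 \<noteq> carrier G"
    and "\<And>x. x \<in> carrier G - (H1 \<union> H2) \<Longrightarrow> card (carrier G) \<le> p ^ m * card (centralizer_elem G x)"
    and "generate G {x \<in> carrier G. card (carrier G) \<le> p ^ k * card (centralizer_elem G x)} = carrier G"
  shows "card (derived G (carrier G)) \<le> p ^ (if m = 0 then 0 else m * (m - 1) div 2 + k)"
  using assms(1,3-)
proof (induction "card (carrier G)" arbitrary: G H1 H2 m k a rule: less_induct)
  case less
  note G = \<open>card (carrier G) = p ^ a\<close> and mk = \<open>m \<le> k\<close>
  note outside = less.prems(8) and gen = less.prems(9)
  interpret group G by fact
  have p1: "p > 1" "p > 0" using p prime_gt_1_nat prime_gt_0_nat by auto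
  have fin: "finite (carrier G)" using G p1 by (metis card_ge_0_finite zero_less_power)
  show ?case
  proof (cases "\<exists>x \<in> carrier G. generate G {x} = carrier G")
    case True
    then show ?thesis using derived_cyclic p1 by auto
  next
    case False
    then obtain M D where M: "maximal_subgroup M G" and D: "subgroup D G" "D \<subseteq> M" "D \<noteq> M"
      "M \<inter> (H1 \<union> H2) \<subseteq> D"
      using ex_maximal_subgroup_avoiding[OF p G less.prems(4-7)] by blast
    interpret M: normal M G by (rule maximal_subgroup_normal[OF M p G])
    have cM: "card (carrier G) = p * card M" by (rule card_maximal_subgroup[OF M p G])
    have finM: "finite M" using fin M.subset finite_subset by blast
    have posM: "card M > 0" using finM M.one_closed card_gt_0_iff by blast
    have lt: "card M < card (carrier G)" using cM p1 posM by simp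
    define K where "K = G\<lparr>carrier := M\<rparr>"
    have carK [simp]: "carrier K = M" by (simp add: K_def)
    interpret K: group K unfolding K_def by (rule M.subgroup_is_group[OF group_axioms])
    have DK: "subgroup D K" unfolding K_def by (rule subgroup_incl[OF D(1) M.subgroup_axioms D(2)])
    have centK: "centralizer_elem K y = M \<inter> centralizer_elem G y" for y
      unfolding K_def by (rule centralizer_elem_carrier_update[OF M.subset])
    obtain b where b: "card (carrier K) = p ^ b"
      using cM G p by (metis carK divides_primepow_nat dvd_triv_right)
    define N where "N = derived G M"
    have N: "N \<lhd> G" unfolding N_def by (rule derived_is_normal[OF M.normal_axioms])
    have NM: "N \<subseteq> M" unfolding N_def by (rule derived_incl[OF subset_refl M.subgroup_axioms])
    have comm: "commutator G x y \<in> N" if "x \<in> M" "y \<in> M" for x y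
      unfolding N_def derived_def using that by (blast intro: generate.incl)
    have derK: "derived K M = N"
      unfolding K_def N_def by (rule derived_consistent[OF subset_refl M.subgroup_axioms])
    \<comment> \<open>The elements of breadth at most \<open>k\<close> generate \<open>G\<close>, so
      one of them lies outside \<open>M\<close>.\<close>
    obtain w where w: "w \<in> carrier G" "w \<notin> M" "card (carrier G) \<le> p ^ k * card (centralizer_elem G w)"
    proof (rule ccontr)
      assume "\<not> thesis"
      then have "{x \<in> carrier G. card (carrier G) \<le> p ^ k * card (centralizer_elem G x)} \<subseteq> M"
        using that by blast
      then have "carrier G \<subseteq> M" using generate_subgroup_incl[OF _ M.subgroup_axioms] gen by metis
      then show False using maximal_subgroup_neq[OF M] M.subset by blast
    qed
    define E where "E = M \<inter> {h \<in> carrier G. commutator G w h \<in> N}"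
    have sE: "subgroup E G" unfolding E_def
      using M.subgroup_axioms commutator_subgroup[OF N w(1)] by (rule subgroups_Inter_pair)
    have EK: "subgroup E K"
      unfolding K_def by (rule subgroup_incl[OF sE M.subgroup_axioms]) (simp add: E_def)
    \<comment> \<open>By \<open>card_derived_le\<close>, \<open>card I\<close> bounds the index of
      \<open>N\<close> in the derived subgroup of \<open>G\<close>.\<close>
    define I where "I = (\<lambda>x. N #>\<^bsub>G\<^esub> commutator G x w) ` M"
    have derG: "card (derived G (carrier G)) \<le> card N * card I"
      unfolding I_def
    proof (rule card_derived_le[OF fin M.normal_axioms N NM comm w(1)])
      show "H = carrier G" if "subgroup H G" "M \<subseteq> H" "w \<in> H" for H
        using maximal_subgroup_cases[OF M that(1,2)] that(3) w(2) by blast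
    qed
    have swap: "commutator G x w \<in> N \<longleftrightarrow> commutator G w x \<in> N" if "x \<in> carrier G" for x
      by (rule commutator_mem_swap[OF normal_imp_subgroup[OF N] that w(1)])
    have IE: "card I * card E \<le> card M"
    proof -
      have "N #>\<^bsub>G\<^esub> commutator G (x \<otimes>\<^bsub>G\<^esub> d) w = N #>\<^bsub>G\<^esub> commutator G x w" if "x \<in> M" "d \<in> E" for x d
        using that swap w by (intro r_coset_commutator_mult[OF N]) (auto simp: E_def)
      then have "card ((\<lambda>x. N #>\<^bsub>G\<^esub> commutator G x w) ` carrier K) * card E \<le> card (carrier K)"
        by (intro K.card_image_mult_le[OF EK]) (auto simp: finM K_def)
      then show ?thesis by (simp add: I_def)
    qed
    \<comment> \<open>On all of \<open>G\<close> the same map is constant on left cosets of the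
      centralizer of \<open>w\<close>, so it has at most \<open>p ^ k\<close> values.\<close>
    have Ik: "card I \<le> p ^ k"
    proof -
      let ?C = "centralizer_elem G w"
      have sC: "subgroup ?C G" by (rule subgroup_centralizer_elem[OF w(1)])
      have "N #>\<^bsub>G\<^esub> commutator G (x \<otimes>\<^bsub>G\<^esub> d) w = N #>\<^bsub>G\<^esub> commutator G x w" if "x \<in> carrier G" "d \<in> ?C" for x d
        using that w subgroup.one_closed[OF normal_imp_subgroup[OF N]] commutator_eq_one_iff[of d w]
        by (intro r_coset_commutator_mult[OF N]) (auto simp: centralizer_elem_def)
      then have "card ((\<lambda>x. N #>\<^bsub>G\<^esub> commutator G x w) ` carrier G) * card ?C \<le> card (carrier G)"
        by (intro card_image_mult_le[OF sC fin])
      moreover have "card I \<le> card ((\<lambda>x. N #>\<^bsub>G\<^esub> commutator G x w) ` carrier G)"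
        unfolding I_def using fin M.subset by (intro card_mono) auto
      ultimately have "card I * card ?C \<le> p ^ k * card ?C"
        using w(3) by (meson le_trans mult_le_mono1)
      moreover have "card ?C > 0"
        using subgroup.one_closed[OF sC] fin by (auto simp: card_gt_0_iff centralizer_elem_def)
      ultimately show ?thesis by simp
    qed
    have outM: "card (carrier K) \<le> p ^ m * card (centralizer_elem K y)" if "y \<in> carrier K - D" for y
    proof -
      have "y \<in> carrier G - (H1 \<union> H2)" using that D(4) M.subset by auto
      then show ?thesis using breadth_subgroup_le[OF M.subgroup_axioms fin _ outside] that
        by (simp add: centK)
    qed
    \<comment> \<open>The centralizer of \<open>y\<close> lies in \<open>M\<close>, and
      \<open>card M\<close> is smaller than \<open>card (carrier G)\<close> by the factor
      \<open>p\<close>, which lowers the exponent by one. For \<open>m = 0\<close> no such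
      \<open>y\<close> exists, as the centralizer would have to be all of \<open>G\<close>.\<close>
    have outE: "m > 0 \<and> card (carrier K) \<le> p ^ (m - 1) * card (centralizer_elem K y)"
      if y: "y \<in> carrier K - (D \<union> E)" for y
    proof -
      have yG: "y \<in> carrier G" "y \<in> carrier G - (H1 \<union> H2)" using y D(4) M.subset by auto
      have "commutator G y w \<notin> N" using y swap yG by (auto simp: E_def)
      then have sub: "centralizer_elem G y \<subseteq> M"
        using centralizer_elem_subset_maximal_subgroup[OF M N comm _ w(1)] y by auto
      then have cent: "centralizer_elem K y = centralizer_elem G y" by (auto simp: centK)
      have le: "p * card M \<le> p ^ m * card (centralizer_elem G y)" using outside[OF yG(2)] cM by simp
      have "card (centralizer_elem G y) \<le> card M" using sub finM by (rule card_mono[rotated])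
      moreover have "card M < p * card M" using p1(1) posM by simp
      ultimately have "\<not> p * card M \<le> card (centralizer_elem G y)" by linarith
      then have "m \<noteq> 0" using le by (metis mult_1 power_0)
      then show ?thesis using le cent p1 by (cases m) (auto simp: mult.assoc)
    qed
    have genD: "generate K (carrier K - D) = carrier K" using K.generate_Diff[OF DK] D(3) by simp
    have genm: "generate K {x \<in> carrier K. card (carrier K) \<le> p ^ m * card (centralizer_elem K x)} = carrier K"
      by (rule K.generate_eq_carrier_mono[OF genD]) (use outM in auto)
    have ltK: "card (carrier K) < card (carrier G)" using lt by simp
    show ?thesis
    proof (cases "E = M")
      \<comment> \<open>Here \<open>card I \<le> 1\<close>, so a bound for \<open>M\<close>
        suffices. Induction takes \<open>D\<close> twice and \<open>m\<close> in place of
        \<open>k\<close>, because the complement of \<open>D\<close> generates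
        \<open>M\<close>.\<close>
      case True
      then have "card I \<le> 1" using IE posM by simp
      then have "card N * card I \<le> card N * 1" by (rule mult_le_mono2)
      then have "card (derived G (carrier G)) \<le> card N" using derG by linarith
      also have "card N = card (derived K (carrier K))" by (simp add: derK)
      also have "\<dots> \<le> p ^ (if m = 0 then 0 else m * (m - 1) div 2 + m)"
        by (rule less.hyps[OF ltK K.group_axioms b order_refl DK _ DK _ _ genm]) (use D(3) outM in auto)
      also have "\<dots> \<le> p ^ (if m = 0 then 0 else m * (m - 1) div 2 + k)"
        using p1 mk by (intro power_increasing) auto
      finally show ?thesis .
    next
      case False
      obtain y where "y \<in> carrier K - (D \<union> E)"
        using K.ex_not_in_two_subgroups[OF DK EK] False D(3) by auto
      then have m0: "m > 0" using outE by blast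
      \<comment> \<open>At \<open>m = 1\<close> truncated subtraction makes both sides zero.\<close>
      have tri: "(m - 1) * (m - 2) div 2 + (m - 1) = m * (m - 1) div 2"
      proof (cases "m = 1")
        case False
        then obtain j where "m = Suc (Suc j)" using m0 by (metis One_nat_def gr0_implies_Suc neq0_conv)
        then show ?thesis by (simp add: algebra_simps)
      qed simp
      show ?thesis
      proof (cases "generate K (carrier K - (D \<union> E)) = carrier K")
        \<comment> \<open>The elements outside \<open>D \<union> E\<close> serve both hypotheses:
          they have breadth at most \<open>m - 1\<close> in \<open>M\<close> and generate it. So
          induction takes \<open>m - 1\<close> in place of both \<open>m\<close> and
          \<open>k\<close>.\<close>
        case True
        have "generate K {x \<in> carrier K. card (carrier K) \<le> p ^ (m - 1) * card (centralizer_elem K x)} = carrier K"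
          by (rule K.generate_eq_carrier_mono[OF True]) (use outE in auto)
        then have "card (derived K (carrier K)) \<le>
            p ^ (if m - 1 = 0 then 0 else (m - 1) * (m - 1 - 1) div 2 + (m - 1))"
          by (intro less.hyps[OF ltK K.group_axioms b order_refl DK _ EK]) (use D(3) False outE in auto)
        moreover have "(if m - 1 = 0 then 0 else (m - 1) * (m - 1 - 1) div 2 + (m - 1)) = m * (m - 1) div 2"
          using tri by (auto simp: numeral_2_eq_2)
        ultimately have "card N \<le> p ^ (m * (m - 1) div 2)" using derK by simp
        then have "card N * card I \<le> p ^ (m * (m - 1) div 2) * p ^ k" using Ik by (rule mult_le_mono)
        then show ?thesis using derG m0 by (simp add: power_add)
      next
        \<comment> \<open>Now \<open>E\<close> has index \<open>p\<close> in \<open>M\<close>, so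
          \<open>card I \<le> p\<close>. Induction takes \<open>m - 1\<close> in place of
          \<open>m\<close> but only \<open>m\<close> in place of \<open>k\<close>, since the
          generators of \<open>M\<close> come from the complement of \<open>D\<close> alone.\<close>
        case False2: False
        have "maximal_subgroup E K"
          by (rule K.maximal_subgroup_if_not_generate[OF p b DK _ EK _ False2]) (use D(3) False in auto)
        then have "card M = p * card E" using K.card_maximal_subgroup[OF _ p b] by simp
        then have "card I \<le> p" using IE posM by auto
        have "card (derived K (carrier K)) \<le>
            p ^ (if m - 1 = 0 then 0 else (m - 1) * (m - 1 - 1) div 2 + m)"
          by (rule less.hyps[OF ltK K.group_axioms b _ DK _ EK _ _ genm]) (use D(3) False outE in auto)
        then have "card N * card I \<le> p ^ (if m - 1 = 0 then 0 else (m - 1) * (m - 1 - 1) div 2 + m) * p"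
          using \<open>card I \<le> p\<close> derK by (intro mult_le_mono) simp_all
        also have "\<dots> = p ^ ((if m - 1 = 0 then 0 else (m - 1) * (m - 1 - 1) div 2 + m) + 1)" by simp
        also have "\<dots> \<le> p ^ (m * (m - 1) div 2 + k)"
        proof (intro power_increasing)
          \<comment> \<open>For \<open>m > 1\<close> the left side is
            \<open>m * (m - 1) div 2 + 2\<close>, and \<open>k \<ge> m \<ge> 2\<close>. For
            \<open>m = 1\<close> it is \<open>1\<close>, which is at most \<open>k\<close>.\<close>
          show "(if m - 1 = 0 then 0 else (m - 1) * (m - 1 - 1) div 2 + m) + 1 \<le> m * (m - 1) div 2 + k"
            using tri mk m0 by (auto simp: numeral_2_eq_2)
        qed (use p1 in simp)
        finally show ?thesis using derG m0 by simp
      qed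
    qed
  qed
qed

section \<open>From orders to breadths and logarithms\<close>

theorem theorem2p1:
  fixes G :: "('a, 'b) monoid_scheme" and p :: nat and n k :: int
  assumes "Factorial_Ring.prime p"
    and "group G" and "finite (carrier G)"
    and "\<exists>m::nat. card (carrier G) = p ^ m"
    and "n \<le> k + 1"
    and "\<exists>H1 H2. subgroup H1 G \<and> H1 \<noteq> carrier G \<and> subgroup H2 G \<and> H2 \<noteq> carrier G \<and>
           (\<forall>x \<in> carrier G. breadth G p x \<ge> real_of_int n \<longrightarrow> x \<in> H1 \<union> H2)"
    and "generate G {x \<in> carrier G. breadth G p x \<le> real_of_int k} = carrier G"
  shows "log (real p) (real (card (derived G (carrier G))))
           \<le> real_of_int ((n - 1) * (n - 2)) / 2 + real_of_int k"
proof -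
  interpret group G by fact
  obtain a where G: "card (carrier G) = p ^ a" using assms(4) by blast
  obtain H1 H2 where H: "subgroup H1 G" "H1 \<noteq> carrier G" "subgroup H2 G" "H2 \<noteq> carrier G"
    and out: "\<And>x. x \<in> carrier G \<Longrightarrow> breadth G p x \<ge> real_of_int n \<Longrightarrow> x \<in> H1 \<union> H2"
    using assms(6) by blast
  have p1: "p > 1" using assms(1) by (rule prime_gt_1_nat)
  \<comment> \<open>The index of a centralizer divides \<open>p ^ a\<close>, so breadths are natural
    numbers.\<close>
  have breadth: "\<exists>b. breadth G p x = real b \<and> card (carrier G) = p ^ b * card (centralizer_elem G x)"
    if x: "x \<in> carrier G" for x
  proof -
    have "card (rcosets\<^bsub>G\<^esub> (centralizer_elem G x)) * card (centralizer_elem G x) = p ^ a"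
      using lagrange[OF subgroup_centralizer_elem[OF x]] G by (simp add: Coset.order_def)
    moreover from this obtain b where "card (rcosets\<^bsub>G\<^esub> (centralizer_elem G x)) = p ^ b"
      using assms(1) by (metis divides_primepow_nat dvd_triv_left)
    ultimately have eq: "card (carrier G) = p ^ b * card (centralizer_elem G x)" using G by simp
    moreover have "card (centralizer_elem G x) \<noteq> 0" using eq G p1 by (metis mult_0_right not_one_less_zero power_not_zero)
    ultimately have "breadth G p x = real b"
      using p1 by (simp add: breadth_def log_nat_power)
    then show ?thesis using eq by blast
  qed
  \<comment> \<open>An element outside \<open>H1 \<union> H2\<close> has breadth below
    \<open>n\<close>, and breadths are nonnegative; so \<open>n \<ge> 1\<close> and
    \<open>n - 1\<close> is a natural number.\<close>
  obtain y where y: "y \<in> carrier G" "y \<notin> H1 \<union> H2" using ex_not_in_two_subgroups H by blast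
  then have "breadth G p y < n" using out[of y] by linarith
  moreover obtain b where "breadth G p y = real b" using breadth y by blast
  ultimately have n1: "n \<ge> 1" by linarith
  define m where "m = nat (n - 1)"
  define k' where "k' = nat k"
  have nk: "n = int m + 1" "k = int k'" and mk: "m \<le> k'" using n1 assms(5) by (auto simp: m_def k'_def)
  have le_iff: "card (carrier G) \<le> p ^ j * card (centralizer_elem G x) \<longleftrightarrow> breadth G p x \<le> real j"
    if x: "x \<in> carrier G" for x j
  proof -
    obtain b where b: "breadth G p x = real b" "card (carrier G) = p ^ b * card (centralizer_elem G x)"
      using breadth x by blast
    have "card (centralizer_elem G x) > 0" using b(2) G p1 by (metis gr0I mult_0_right not_one_less_zero power_not_zero)
    then show ?thesis using p1 by (simp add: b(1)) (simp add: b(2))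
  qed
  have "card (derived G (carrier G)) \<le> p ^ (if m = 0 then 0 else m * (m - 1) div 2 + k')"
  proof (rule card_derived_bound[OF assms(2,1) G mk H])
    \<comment> \<open>Breadth below \<open>n\<close> means breadth at most \<open>m = n - 1\<close>,
      by integrality.\<close>
    show "card (carrier G) \<le> p ^ m * card (centralizer_elem G x)" if x: "x \<in> carrier G - (H1 \<union> H2)" for x
    proof -
      obtain b where b: "breadth G p x = real b" using breadth x by blast
      then show ?thesis using out[of x] x le_iff[of x m] nk(1) by auto
    qed
    have "{x \<in> carrier G. card (carrier G) \<le> p ^ k' * card (centralizer_elem G x)} =
        {x \<in> carrier G. breadth G p x \<le> real_of_int k}" using le_iff nk(2) by auto
    then show "generate G {x \<in> carrier G. card (carrier G) \<le> p ^ k' * card (centralizer_elem G x)} = carrier G"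
      using assms(7) by simp
  qed
  also have "\<dots> \<le> p ^ (m * (m - 1) div 2 + k')" using p1 by (intro power_increasing) auto
  finally have "card (derived G (carrier G)) \<le> p ^ (m * (m - 1) div 2 + k')" .
  moreover have "card (derived G (carrier G)) > 0"
    using subgroup.one_closed[OF derived_is_subgroup[of "carrier G"]] derived_in_carrier[of "carrier G"]
      assms(3) by (metis card_gt_0_iff empty_iff finite_subset subset_refl)
  ultimately have "log p (card (derived G (carrier G))) \<le> log p (p ^ (m * (m - 1) div 2 + k'))"
    using p1 by (subst log_le_cancel_iff) (auto simp: of_nat_le_iff simp flip: of_nat_power)
  also have "\<dots> = real (m * (m - 1) div 2 + k')" using p1 by (simp add: log_nat_power)
  also have "real (m * (m - 1) div 2 + k') = real (m * (m - 1) div 2) + real k'" by simp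
  also have "real (m * (m - 1) div 2) = real (m * (m - 1)) / 2"
  proof -
    have "2 dvd m * (m - 1)" by (cases m) auto
    then show ?thesis by (simp add: real_of_nat_div)
  qed
  \<comment> \<open>At \<open>m = 0\<close> both sides vanish, so truncated subtraction does no
    harm.\<close>
  also have "real (m * (m - 1)) = real_of_int ((n - 1) * (n - 2))"
    using nk(1) by (cases m) (auto simp: algebra_simps)
  finally show ?thesis using nk(2) by simp
qed

end
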